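(* Let $\varepsilon\in(0,1)$ and $T>0$ be fixed, and set $$\lambda_{\varepsilon,T}=\frac{3\sqrt{\pi}}{4}\,\frac{\varepsilon}{T^{3/2}}.$$ For $\lambda\in\mathbb{R}$ let $g_{\lambda}$ be the solution of the Volterra integral equation $$g_\lambda(t)=1-\frac{2\lambda}{\sqrt{\pi}}\int_{0}^{t}g_\lambda(\tau)\sqrt{t-\tau}\,d\tau,\quad t>0.$$ Then $$\|g_{\lambda}\|_{T}\leq\frac{1}{1-\varepsilon}\quad\text{for all }\lambda\text{ with }|\lambda|\leq\lambda_{\varepsilon,T}.$$ Moreover, the map $\lambda\mapsto g_{\lambda}$ from $[-\lambda_{\varepsilon,T},\lambda_{\varepsilon,T}]$ to $C([0,T])$ is Lipschitz continuous.
   Context: For $g\in C([0,T])$, $\|g\|_{T}=\max_{0\leq t\leq T}|g(t)|$, and $C([0,T])$ is equipped with this norm. The solution $g_\lambda$ is the continuous function on $[0,+\infty)$ satisfying the Volterra equation. *)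

theory Defs
  imports "HOL-Analysis.Analysis"
begin

(* Functions on [0, +infinity) are represented by total functions real => real;
   values at negative arguments are irrelevant. *)
definition volterra_solution :: "real \<Rightarrow> (real \<Rightarrow> real) \<Rightarrow> bool" where
  "volterra_solution lam g \<longleftrightarrow>
     continuous_on {0..} g \<and>
     (\<forall>t>0. g t = 1 - 2 * lam / sqrt pi * integral {0..t} (\<lambda>s. g s * sqrt (t - s)))"

definition lambda_bound :: "real \<Rightarrow> real \<Rightarrow> real" where
  "lambda_bound eps T = 3 * sqrt pi / 4 * (eps / T powr (3/2))"

(* The supremum is a maximum for continuous g and T >= 0, see max_norm_attained. *)
definition max_norm :: "real \<Rightarrow> (real \<Rightarrow> real) \<Rightarrow> real" where
  "max_norm T g = (SUP t\<in>{0..T}. \<bar>g t\<bar>)"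

(* C([0,T]): its points are the continuous functions on {0..T}, extended by
   undefined outside {0..T}. *)
definition cont_space :: "real \<Rightarrow> (real \<Rightarrow> real) metric" where
  "cont_space T = cfunspace (top_of_set {0..T}) euclidean_metric"

lemma max_norm_attained:
  assumes "continuous_on {0..T} g" "0 \<le> T"
  shows "\<exists>t\<in>{0..T}. max_norm T g = \<bar>g t\<bar> \<and> (\<forall>s\<in>{0..T}. \<bar>g s\<bar> \<le> \<bar>g t\<bar>)"
proof -
  have "continuous_on {0..T} (\<lambda>t. \<bar>g t\<bar>)"
    using assms(1) by (intro continuous_intros)
  then obtain t where t: "t \<in> {0..T}" "\<And>s. s \<in> {0..T} \<Longrightarrow> \<bar>g s\<bar> \<le> \<bar>g t\<bar>"
    using continuous_attains_sup[of "{0..T}" "\<lambda>t. \<bar>g t\<bar>"] assms(2) by auto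
  have "max_norm T g = \<bar>g t\<bar>"
    unfolding max_norm_def using t by (intro cSup_eq_maximum) auto
  with t show ?thesis by blast
qed

lemma mspace_cont_space:
  "mspace (cont_space T) = {f \<in> extensional {0..T}. continuous_on {0..T} f}"
proof -
  have "bounded (f ` {0..T})" if "continuous_on {0..T} f" for f :: "real \<Rightarrow> real"
    using that by (intro compact_imp_bounded compact_continuous_image) auto
  then show ?thesis
    by (auto simp: cont_space_def)
qed

lemma mdist_cont_space:
  assumes "0 \<le> T" "f \<in> mspace (cont_space T)" "h \<in> mspace (cont_space T)"
  shows "mdist (cont_space T) f h = max_norm T (\<lambda>t. f t - h t)"
proof -
  have "f \<in> mspace (funspace {0..T} euclidean_metric)" "h \<in> mspace (funspace {0..T} euclidean_metric)"
    using assms(2,3) cfunspace_subset_funspace[of "top_of_set {0..T}" "euclidean_metric :: real metric"]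
    unfolding cont_space_def by auto
  then show ?thesis
    using assms(1)
    by (simp add: cont_space_def mdist_cfunspace_eq_mdist_funspace max_norm_def dist_real_def
        Metric_space.fdist_def[OF Metric_space_mspace_mdist[of "euclidean_metric :: real metric", simplified]])
qed

end

theory Submission
  imports Defs
begin

text \<open>The Abel-type operator sending \<open>u\<close> to \<open>\<integral>\<^sub>0\<^sup>t u(s) sqrt (t - s) ds\<close> has norm
  \<open>(2/3) T\<^sup>3\<^sup>/\<^sup>2\<close> on \<open>C([0,T])\<close>, so \<open>lambda_bound eps T\<close> is exactly the value of
  \<open>\<bar>lam\<bar>\<close> at which the integral term of the Volterra equation has norm \<open>eps\<close>. An inequality
  \<open>\<parallel>u\<parallel> \<le> A + eps \<parallel>u\<parallel>\<close> then gives \<open>\<parallel>u\<parallel> \<le> A / (1 - eps)\<close>. This is applied first to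
  \<open>u = g lam\<close> with \<open>A = 1\<close>, and then to \<open>u = g lam - g mu\<close>, which satisfies the same equation
  with the constant term replaced by \<open>(lam - mu)\<close> times the integral of \<open>g mu\<close>.\<close>

lemma has_integral_sqrt_diff:
  fixes t :: real
  assumes "0 \<le> t"
  shows "((\<lambda>s. sqrt (t - s)) has_integral 2 / 3 * (t * sqrt t)) {0..t}"
proof -
  let ?F = "\<lambda>s. - (2 / 3) * ((t - s) * sqrt (t - s))"
  have "((\<lambda>s. sqrt (t - s)) has_integral ?F t - ?F 0) {0..t}"
  \<comment> \<open>The chain rule for \<open>sqrt\<close> breaks down at \<open>s = t\<close>,
    where its argument vanishes, so \<open>?F\<close> is differentiated only in the open
    interval.\<close>
  proof (rule fundamental_theorem_of_calculus_interior)
    fix s assume "s \<in> {0<..<t}"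
    then have s: "t - s > 0" by simp
    then have sq: "sqrt (t - s) * (sqrt (t - s) * c) = (t - s) * c" for c
      by (simp flip: mult.assoc)
    from s have "(?F has_real_derivative sqrt (t - s)) (at s)"
      by (auto intro!: derivative_eq_intros simp: field_simps) (simp add: sq)
    then show "(?F has_vector_derivative sqrt (t - s)) (at s)"
      by (simp add: has_real_derivative_iff_has_vector_derivative)
  qed (use assms in \<open>auto intro!: continuous_intros\<close>)
  then show ?thesis by simp
qed

lemma max_norm_upper:
  assumes "continuous_on {0..T} u" "t \<in> {0..T}"
  shows "\<bar>u t\<bar> \<le> max_norm T u"
  using max_norm_attained[OF assms(1)] assms(2) by auto

lemma integrable_mult_sqrt_diff:
  fixes u :: "real \<Rightarrow> real"
  assumes "continuous_on {0..T} u" "t \<le> T"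
  shows "(\<lambda>s. u s * sqrt (t - s)) integrable_on {0..t}"
  using assms by (intro integrable_continuous_interval continuous_intros)
    (auto elim: continuous_on_subset)

text \<open>The maximum of \<open>\<bar>u\<bar>\<close> is pulled out of the integral; what remains
  is the integral of the kernel, which increases with \<open>t\<close> and is therefore largest at
  \<open>t = T\<close>.\<close>

lemma abs_integral_mult_sqrt_diff_le:
  assumes "continuous_on {0..T} u" "0 \<le> t" "t \<le> T"
  shows "\<bar>integral {0..t} (\<lambda>s. u s * sqrt (t - s))\<bar> \<le> max_norm T u * (2 / 3 * T powr (3 / 2))"
proof -
  have M: "\<bar>u s\<bar> \<le> max_norm T u" if "s \<in> {0..t}" for s
    using max_norm_upper[OF assms(1)] that assms by auto
  then have "0 \<le> max_norm T u"
    using assms(2) by (force intro: order_trans[OF abs_ge_zero M[of 0]])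
  note int = has_integral_mult_right[OF has_integral_sqrt_diff[OF assms(2)], of "max_norm T u"]
  have "norm (integral {0..t} (\<lambda>s. u s * sqrt (t - s)))
      \<le> integral {0..t} (\<lambda>s. max_norm T u * sqrt (t - s))"
    using M int by (intro integral_norm_bound_integral integrable_mult_sqrt_diff[OF assms(1,3)])
      (auto simp: abs_mult intro!: mult_right_mono)
  also have "\<dots> = max_norm T u * (2 / 3 * (t * sqrt t))"
    using int by (rule integral_unique)
  also have "\<dots> \<le> max_norm T u * (2 / 3 * (T * sqrt T))"
    using assms \<open>0 \<le> max_norm T u\<close> by (intro mult_left_mono mult_mono) auto
  also have "T * sqrt T = T powr (3 / 2)"
    using assms powr_add[of T 1 "1 / 2"] by (simp add: powr_half_sqrt)
  finally show ?thesis by simp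
qed

text \<open>The equation is only imposed for \<open>t > 0\<close>; the value at \<open>0\<close> is controlled by continuity.\<close>

lemma max_norm_le_if_pos:
  assumes "continuous_on {0..T} u" "0 < T" "\<And>t. 0 < t \<Longrightarrow> t \<le> T \<Longrightarrow> \<bar>u t\<bar> \<le> B"
  shows "max_norm T u \<le> B"
proof -
  have cl: "closure {0<..T} = {0..T}" using assms(2) by simp
  have "\<bar>u t\<bar> \<le> B" if "t \<in> {0..T}" for t
    using continuous_on_closure_norm_le[of "{0<..T}" u B t] assms that by (simp add: cl)
  then show ?thesis
    unfolding max_norm_def using assms(2) by (intro cSUP_least) auto
qed

lemma max_norm_volterra_le:
  assumes "continuous_on {0..T} u" "0 < T" "eps < 1" "\<bar>lam\<bar> \<le> lambda_bound eps T"
    and le: "\<And>t. 0 < t \<Longrightarrow> t \<le> T \<Longrightarrow>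
      \<bar>u t\<bar> \<le> A + \<bar>2 * lam / sqrt pi * integral {0..t} (\<lambda>s. u s * sqrt (t - s))\<bar>"
  shows "max_norm T u \<le> A / (1 - eps)"
proof -
  have T: "0 < T powr (3 / 2)" using assms(2) by simp
  have M: "0 \<le> max_norm T u"
    using max_norm_upper[OF assms(1), of T] assms(2) by simp
  \<comment> \<open>The factor \<open>4 * T powr (3 / 2) / (3 * sqrt pi)\<close> multiplying
    \<open>\<bar>lam\<bar>\<close> is the reciprocal of
    \<open>lambda_bound eps T / eps\<close>.\<close>
  have k: "\<bar>2 * lam / sqrt pi\<bar> * (2 / 3 * T powr (3 / 2)) \<le> eps"
    using assms(4) T by (simp add: lambda_bound_def abs_mult field_simps)
  have "max_norm T u \<le> A + eps * max_norm T u"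
  proof (rule max_norm_le_if_pos[OF assms(1,2)])
    fix t assume t: "0 < t" "t \<le> T"
    have "\<bar>2 * lam / sqrt pi\<bar> * \<bar>integral {0..t} (\<lambda>s. u s * sqrt (t - s))\<bar>
        \<le> \<bar>2 * lam / sqrt pi\<bar> * (max_norm T u * (2 / 3 * T powr (3 / 2)))"
      using t by (intro mult_left_mono abs_integral_mult_sqrt_diff_le[OF assms(1)]) auto
    also have "\<dots> \<le> eps * max_norm T u"
      using mult_right_mono[OF k M] by (simp add: mult_ac)
    finally show "\<bar>u t\<bar> \<le> A + eps * max_norm T u"
      using le[OF t] unfolding abs_mult by linarith
  qed
  then show ?thesis
    using assms(3) by (simp add: field_simps)
qed

lemma volterra_solution_continuous_on:
  assumes "volterra_solution lam g"
  shows "continuous_on {0..T} g"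
  using assms by (auto simp: volterra_solution_def elim: continuous_on_subset)

lemma max_norm_volterra_solution:
  assumes "volterra_solution lam g" "0 < T" "eps < 1" "\<bar>lam\<bar> \<le> lambda_bound eps T"
  shows "max_norm T g \<le> 1 / (1 - eps)"
proof (rule max_norm_volterra_le[OF volterra_solution_continuous_on[OF assms(1)] assms(2-4)])
  fix t :: real assume "0 < t"
  with assms(1) have "g t = 1 - 2 * lam / sqrt pi * integral {0..t} (\<lambda>s. g s * sqrt (t - s))"
    by (simp add: volterra_solution_def)
  then show "\<bar>g t\<bar> \<le> 1 + \<bar>2 * lam / sqrt pi * integral {0..t} (\<lambda>s. g s * sqrt (t - s))\<bar>"
    by linarith
qed

text \<open>One factor \<open>1 / (1 - eps)\<close> comes from the bound on \<open>h\<close>, the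
  other from absorbing the integral of \<open>g - h\<close>. The rest of the constant is
  \<open>2 / sqrt pi\<close> times the kernel bound \<open>2 / 3 * T powr (3 / 2)\<close>.\<close>

lemma max_norm_volterra_solution_diff:
  assumes g: "volterra_solution lam g" and h: "volterra_solution mu h"
    and "0 < T" "eps < 1" "\<bar>lam\<bar> \<le> lambda_bound eps T" "\<bar>mu\<bar> \<le> lambda_bound eps T"
  shows "max_norm T (\<lambda>t. g t - h t) \<le> 4 * T powr (3 / 2) / (3 * sqrt pi * (1 - eps)\<^sup>2) * \<bar>lam - mu\<bar>"
proof -
  let ?K = "\<bar>2 * (lam - mu) / sqrt pi\<bar> * (1 / (1 - eps) * (2 / 3 * T powr (3 / 2)))"
  note contg = volterra_solution_continuous_on[OF g, of T]
  note conth = volterra_solution_continuous_on[OF h, of T]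
  have "max_norm T (\<lambda>t. g t - h t) \<le> ?K / (1 - eps)"
  proof (rule max_norm_volterra_le[OF continuous_on_diff[OF contg conth] assms(3-5)])
    fix t assume t: "0 < t" "t \<le> T"
    let ?I = "\<lambda>u. integral {0..t} (\<lambda>s. u s * sqrt (t - s))"
    have "?I (\<lambda>s. g s - h s) = ?I g - ?I h"
      unfolding left_diff_distrib
      by (intro integral_diff integrable_mult_sqrt_diff[OF contg] integrable_mult_sqrt_diff[OF conth] t)
    moreover have "g t = 1 - 2 * lam / sqrt pi * ?I g" "h t = 1 - 2 * mu / sqrt pi * ?I h"
      using g h t by (simp_all add: volterra_solution_def)
    \<comment> \<open>Adding and subtracting \<open>lam * ?I h\<close> splits
      \<open>lam * ?I g - mu * ?I h\<close> into \<open>lam * ?I (g - h)\<close> and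
      \<open>(lam - mu) * ?I h\<close>.\<close>
    ultimately have eq: "g t - h t =
        - (2 * lam / sqrt pi * ?I (\<lambda>s. g s - h s)) - 2 * (lam - mu) / sqrt pi * ?I h"
      by (simp add: left_diff_distrib right_diff_distrib diff_divide_distrib)
    have "\<bar>?I h\<bar> \<le> max_norm T h * (2 / 3 * T powr (3 / 2))"
      using t by (intro abs_integral_mult_sqrt_diff_le[OF conth]) auto
    also have "\<dots> \<le> 1 / (1 - eps) * (2 / 3 * T powr (3 / 2))"
      by (intro mult_right_mono max_norm_volterra_solution[OF h] assms) auto
    finally have "\<bar>2 * (lam - mu) / sqrt pi * ?I h\<bar> \<le> ?K"
      unfolding abs_mult by (intro mult_left_mono) auto
    with eq show "\<bar>g t - h t\<bar> \<le> ?K + \<bar>2 * lam / sqrt pi * ?I (\<lambda>s. g s - h s)\<bar>"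
      by linarith
  qed
  also have "?K / (1 - eps) = 4 * T powr (3 / 2) / (3 * sqrt pi * (1 - eps)\<^sup>2) * \<bar>lam - mu\<bar>"
    \<comment> \<open>The distributive rules would expand \<open>2 * (lam - mu)\<close> and hide the
      factor \<open>\<bar>lam - mu\<bar>\<close>.\<close>
    by (simp add: abs_mult power2_eq_square mult_ac del: right_diff_distrib_numeral left_diff_distrib_numeral)
  finally show ?thesis .
qed

theorem theorem3p1:
  fixes eps T :: real and g :: "real \<Rightarrow> real \<Rightarrow> real"
  assumes "0 < eps" and "eps < 1" and "T > 0"
    and "\<And>lam. volterra_solution lam (g lam)"
  shows "(\<forall>lam. \<bar>lam\<bar> \<le> lambda_bound eps T \<longrightarrow> max_norm T (g lam) \<le> 1 / (1 - eps)) \<and>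
    Lipschitz_continuous_map
      (submetric euclidean_metric {- lambda_bound eps T .. lambda_bound eps T})
      (cont_space T)
      (\<lambda>lam. restrict (g lam) {0..T})"
proof
  show "\<forall>lam. \<bar>lam\<bar> \<le> lambda_bound eps T \<longrightarrow> max_norm T (g lam) \<le> 1 / (1 - eps)"
    using max_norm_volterra_solution assms by blast
  \<comment> \<open>Points of \<open>cont_space T\<close> must be extensional, hence
    \<open>restrict\<close>; values on \<open>{0..T}\<close>, and so continuity and distances, are
    unaffected.\<close>
  have mem: "restrict (g lam) {0..T} \<in> mspace (cont_space T)" for lam
    using volterra_solution_continuous_on[OF assms(4), of T lam]
    unfolding mspace_cont_space by (auto cong: continuous_on_cong_simp)
  have "mdist (cont_space T) (restrict (g lam) {0..T}) (restrict (g mu) {0..T})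
      = max_norm T (\<lambda>t. g lam t - g mu t)" for lam mu
    using assms(3) mem by (simp add: mdist_cont_space max_norm_def cong: SUP_cong_simp)
  moreover have "max_norm T (\<lambda>t. g lam t - g mu t)
      \<le> 4 * T powr (3 / 2) / (3 * sqrt pi * (1 - eps)\<^sup>2) * \<bar>lam - mu\<bar>"
    if "lam \<in> {- lambda_bound eps T .. lambda_bound eps T}"
      "mu \<in> {- lambda_bound eps T .. lambda_bound eps T}" for lam mu
    using that assms by (intro max_norm_volterra_solution_diff) auto
  ultimately show "Lipschitz_continuous_map
      (submetric euclidean_metric {- lambda_bound eps T .. lambda_bound eps T})
      (cont_space T) (\<lambda>lam. restrict (g lam) {0..T})"
    unfolding Lipschitz_continuous_map_def using mem
    by (auto simp: dist_real_def intro!: exI[of _ "4 * T powr (3 / 2) / (3 * sqrt pi * (1 - eps)\<^sup>2)"])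
qed

end
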